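(* Let $\theta\in(0,\pi/2)$ and consider any hierarchical tiling with basic angle $\theta$. The number of sizes in which the basic triangle appears in the tiling is infinite if $\ln(\sin\theta)/\ln[(\cos\theta)/2]$ is irrational, and finite if $\ln(\sin\theta)/\ln[(\cos\theta)/2]$ is rational. In particular, if $\ln(\sin\theta)/\ln[(\cos\theta)/2]=p/q$ with $p$ and $q$ relatively prime (positive) integers, then the number of sizes in the tiling is $\max(p,q)$.
   Context: Fix positive reals $a,b,c$ with $a^2+b^2=c^2$ and let $\theta=\arcsin(a/c)\in(0,\pi/2)$. A tile is a right triangle with an ordered triple of vertices $(A,C,B)$, with right angle at $C$ and angle $\theta$ at $A$, so that $|AC|:|CB|:|AB|=b:a:c$. $AC$ is called the long leg and $CB$ the short leg (even if $b\le a$). Subdivision rule: let $F$ be the foot of the perpendicular from $C$ to $AB$, and let $M,N,K$ be the midpoints of $AC$, $AF$, $FC$. The tile $(A,C,B)$ is divided into the five daughter tiles $(A,N,M)$, $(M,K,C)$, $(M,K,F)$, $(F,N,M)$ (each smaller than the parent by the linear factor $b/(2c)$) and $(C,F,B)$ (smaller by the linear factor $a/c$). Let $T$ be the basic tile with hypotenuse $c$. Put $T_0=\{T\}$, and for $n\ge1$ let $T_n$ be obtained from $T_{n-1}$ by subdividing every tile of $T_{n-1}$ that has the largest hypotenuse occurring in $T_{n-1}$. A supertile of order $n$ is a collection of tiles of the form $e(s(T_n))$, where $s$ is a rescaling and $e$ is a Euclidean motion (possibly orientation reversing). A hierarchical tiling with basic angle $\theta$ is a tiling of an infinite region (typically the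 whole plane) that is the union of supertiles $S_1\subsetneq S_2\subsetneq\cdots$ of orders $N_1<N_2<\cdots$, where for each $i$, writing $S_{i+1}=e(s(T_{N_{i+1}}))$, there are $n\le N_{i+1}$ and a tile $t\in T_n$ such that $S_i$ is the image under $e\circ s$ of the set of tiles of $T_{N_{i+1}}$ contained in $t$. The size of a tile is its hypotenuse length; the number of sizes is the number of distinct hypotenuse lengths occurring in the tiling. *)

theory Defs
  imports "HOL-Analysis.Analysis"
begin

text \<open>A tile is stored as its ordered triple of vertices \<open>(A, C, B)\<close>, with the right angle at the
  middle vertex \<open>C\<close>; the Euclidean plane is \<^typ>\<open>complex\<close>.\<close>

type_synonym tile = "complex \<times> complex \<times> complex"

definition is_tile :: "real \<Rightarrow> real \<Rightarrow> real \<Rightarrow> tile \<Rightarrow> bool" where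
  "is_tile a b c = (\<lambda>(A, C, B). orthogonal (A - C) (B - C) \<and>
     (\<exists>r>0. dist A C = r * b \<and> dist C B = r * a \<and> dist A B = r * c))"

definition region :: "tile \<Rightarrow> complex set" where
  "region = (\<lambda>(A, C, B). convex hull {A, C, B})"

definition hypotenuse :: "tile \<Rightarrow> real" where
  "hypotenuse = (\<lambda>(A, C, B). dist A B)"

definition map_tile :: "(complex \<Rightarrow> complex) \<Rightarrow> tile \<Rightarrow> tile" where
  "map_tile f = (\<lambda>(A, C, B). (f A, f C, f B))"

text \<open>Foot of the perpendicular from \<open>P\<close> to the line through the distinct points \<open>A\<close> and \<open>B\<close>.\<close>

definition foot :: "complex \<Rightarrow> complex \<Rightarrow> complex \<Rightarrow> complex" where
  "foot P A B = A + (((P - A) \<bullet> (B - A)) / ((B - A) \<bullet> (B - A))) *\<^sub>R (B - A)"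

definition subdivide :: "tile \<Rightarrow> tile set" where
  "subdivide = (\<lambda>(A, C, B).
     let F = foot C A B; M = midpoint A C; N = midpoint A F; K = midpoint F C
     in {(A, N, M), (M, K, C), (M, K, F), (F, N, M), (C, F, B)})"

primrec subdivision :: "tile \<Rightarrow> nat \<Rightarrow> tile set" where
  "subdivision T 0 = {T}"
| "subdivision T (Suc n) =
     (\<Union>t\<in>subdivision T n.
        if hypotenuse t = Max (hypotenuse ` subdivision T n) then subdivide t else {t})"

text \<open>Isometries of the plane, orientation reversing ones included.\<close>

definition euclidean_motion :: "(complex \<Rightarrow> complex) \<Rightarrow> bool" where
  "euclidean_motion e \<longleftrightarrow> (\<forall>x y. dist (e x) (e y) = dist x y)"

text \<open>A rescaling (about the origin) followed by a Euclidean motion.\<close>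

definition placement :: "(complex \<Rightarrow> complex) \<Rightarrow> bool" where
  "placement f \<longleftrightarrow> (\<exists>e r. euclidean_motion e \<and> r > 0 \<and> f = (\<lambda>z. e (r *\<^sub>R z)))"

definition supertile :: "tile \<Rightarrow> nat \<Rightarrow> tile set \<Rightarrow> bool" where
  "supertile T n S \<longleftrightarrow> (\<exists>f. placement f \<and> S = map_tile f ` subdivision T n)"

definition tiling_of :: "complex set \<Rightarrow> tile set \<Rightarrow> bool" where
  "tiling_of X \<T> \<longleftrightarrow> (\<Union>t\<in>\<T>. region t) = X \<and>
     pairwise (\<lambda>t u. interior (region t) \<inter> interior (region u) = {}) \<T>"

text \<open>The chain of supertiles is indexed from 0. An infinite region is an unbounded one.\<close>

definition hierarchical_tiling :: "tile \<Rightarrow> tile set \<Rightarrow> bool" where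
  "hierarchical_tiling T \<T> \<longleftrightarrow>
     (\<exists>X. \<not> bounded X \<and> tiling_of X \<T>) \<and>
     (\<exists>S N. \<T> = (\<Union>i. S i) \<and> (\<forall>i. S i \<subset> S (Suc i)) \<and> strict_mono N \<and>
        (\<forall>i. supertile T (N i) (S i)) \<and>
        (\<forall>i. \<exists>f. placement f \<and> S (Suc i) = map_tile f ` subdivision T (N (Suc i)) \<and>
           (\<exists>n\<le>N (Suc i). \<exists>t\<in>subdivision T n.
              S i = map_tile f ` {u \<in> subdivision T (N (Suc i)). region u \<subseteq> region t})))"

definition sizes :: "tile set \<Rightarrow> real set" where
  "sizes \<T> = hypotenuse ` \<T>"

end

theory Submission
  imports Defs
begin

text \<open>On logarithmic scale the sizes of \<open>T\<^sub>n\<close> form a finite set of depths, and a subdivision step replaces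
  its minimum \<open>L\<close> by \<open>L + k\<close> and \<open>L + m\<close>, where \<open>k \<le> m\<close> are \<open>- ln (sin \<theta>)\<close> and \<open>- ln (cos \<theta> / 2)\<close>
  in increasing order. All depths stay in a half-open window of length \<open>m\<close> above the minimum, so each
  residue class modulo \<open>m\<close> contributes at most one depth; a class once present never disappears, and
  with the class of \<open>d\<close> that of \<open>d + k\<close> appears eventually. The number of sizes of \<open>T\<^sub>n\<close> hence tends to the
  order of \<open>k\<close> in \<open>\<real> / m\<int>\<close>. The sizes of the supertiles of the tiling form an increasing chain
  of sets, so this order is also the number of sizes of the tiling.\<close>

section \<open>The evolution of the depths\<close>

text \<open>Sets instead of multisets suffice, because tiles of equal size are subdivided together:
  once treated, the minimal depth disappears altogether. Requiring \<open>k \<le> m\<close> lets one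
  analysis serve both orderings of the two scaling factors.\<close>

locale depth_process =
  fixes k m :: real and D :: "nat \<Rightarrow> real set" and d0 :: real
  assumes k_pos: "0 < k" and k_le_m: "k \<le> m"
    and D_0: "D 0 = {d0}"
    and D_Suc: "\<And>n. D (Suc n) = insert (Min (D n) + k) (insert (Min (D n) + m) (D n - {Min (D n)}))"
begin

abbreviation L :: "nat \<Rightarrow> real" where "L n \<equiv> Min (D n)"

lemma m_pos: "0 < m"
  using k_pos k_le_m by simp

lemma finite_D: "finite (D n)"
  by (induction n) (auto simp: D_0 D_Suc)

lemma D_nonempty: "D n \<noteq> {}"
  by (cases n) (auto simp: D_0 D_Suc)

lemma L_in: "L n \<in> D n"
  using Min_in[OF finite_D D_nonempty] .

lemma L_le: "x \<in> D n \<Longrightarrow> L n \<le> x"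
  using Min_le[OF finite_D] .

lemma L_less_Suc: "L n < L (Suc n)"
proof -
  have "L n < x" if "x \<in> D (Suc n)" for x
    using that k_pos m_pos L_le[of x n] unfolding D_Suc by auto
  then show ?thesis using L_in by blast
qed

lemma strict_mono_L: "strict_mono L"
  using L_less_Suc by (simp add: strict_mono_Suc_iff)

text \<open>The window moves up with the minimum. The largest depth a step can add is
  \<open>L n + m\<close>, which lies strictly below \<open>L (Suc n) + m\<close> since the minimum
  strictly increases.\<close>

lemma D_window: "x \<in> D n \<Longrightarrow> x < L n + m"
proof (induction n arbitrary: x)
  case 0
  then show ?case using m_pos by (simp add: D_0)
next
  case (Suc n)
  then show ?case
    using L_less_Suc[of n] k_le_m unfolding D_Suc[of n] by fastforce
qed

lemma D_combination: "x \<in> D n \<Longrightarrow> \<exists>i j. x = d0 + real i * k + real j * m"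
proof (induction n arbitrary: x)
  case 0
  then have "x = d0 + real 0 * k + real 0 * m" by (simp add: D_0)
  then show ?case by blast
next
  case (Suc n)
  from Suc.IH[OF L_in] obtain i j where ij: "L n = d0 + real i * k + real j * m" by blast
  have "L n + k = d0 + real (Suc i) * k + real j * m" "L n + m = d0 + real i * k + real (Suc j) * m"
    unfolding ij by (simp_all add: algebra_simps)
  then show ?case using Suc.prems Suc.IH unfolding D_Suc by blast
qed

lemma finite_depths_below: "finite {x. x \<le> s \<and> (\<exists>n. x \<in> D n)}"
proof (rule finite_subset)
  let ?u = "nat \<lceil>(s - d0) / k\<rceil>" and ?v = "nat \<lceil>(s - d0) / m\<rceil>"
  show "{x. x \<le> s \<and> (\<exists>n. x \<in> D n)} \<subseteq> (\<lambda>(i, j). d0 + real i * k + real j * m) ` ({..?u} \<times> {..?v})"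
  proof
    fix x assume "x \<in> {x. x \<le> s \<and> (\<exists>n. x \<in> D n)}"
    then obtain i j where x: "x = d0 + real i * k + real j * m" and le: "x \<le> s"
      using D_combination by blast
    have "0 \<le> real i * k" "0 \<le> real j * m" using k_pos m_pos by simp_all
    then have "real i * k \<le> s - d0" "real j * m \<le> s - d0" using x le by linarith+
    then have "real i \<le> (s - d0) / k" "real j \<le> (s - d0) / m"
      using k_pos m_pos by (simp_all add: pos_le_divide_eq)
    then have "i \<le> ?u" "j \<le> ?v" by linarith+
    then show "x \<in> (\<lambda>(i, j). d0 + real i * k + real j * m) ` ({..?u} \<times> {..?v})"
      using x by force
  qed
qed simp

section \<open>Appearance and persistence of residue classes modulo m\<close>

text \<open>A depth is removed only when it is the minimum. Were \<open>s\<close> never minimal, it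
  would stay and bound all later minima from above; but these are pairwise distinct, and only
  finitely many depths lie below \<open>s\<close>.\<close>

lemma eventually_minimal:
  assumes "s \<in> D n"
  shows "\<exists>n'\<ge>n. L n' = s"
proof (rule ccontr)
  assume never: "\<not> ?thesis"
  have stays: "s \<in> D (n + i)" for i
  proof (induction i)
    case (Suc i)
    have "L (n + i) \<noteq> s" using never by auto
    with Suc show ?case by (auto simp: D_Suc)
  qed (simp add: assms)
  have "range (\<lambda>i. L (n + i)) \<subseteq> {x. x \<le> s \<and> (\<exists>n. x \<in> D n)}"
    using L_le[OF stays] L_in by blast
  then have "finite (range (\<lambda>i. L (n + i)))"
    using finite_depths_below finite_subset by blast
  moreover have "inj (\<lambda>i. L (n + i))"
    using strict_mono_eq[OF strict_mono_L] by (auto intro!: injI)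
  ultimately show False using finite_imageD infinite_UNIV_nat by blast
qed

text \<open>The only representative a step can remove is the minimum, and the same step inserts that
  minimum plus \<open>m\<close>, which lies in the same class.\<close>

lemma class_persists:
  assumes "s \<in> D n" and "n \<le> n'"
  shows "\<exists>i. s + real i * m \<in> D n'"
  using assms(2)
proof (induction n' rule: dec_induct)
  case base
  have "s + real 0 * m \<in> D n" using assms(1) by simp
  then show ?case by blast
next
  case (step n')
  then obtain i where i: "s + real i * m \<in> D n'" by blast
  show ?case
  proof (cases "s + real i * m = L n'")
    case True
    then have "s + real (Suc i) * m = L n' + m" by (simp add: algebra_simps)
    then show ?thesis unfolding D_Suc by blast
  next
    case False
    then show ?thesis using i unfolding D_Suc by blast
  qed
qed

text \<open>Once the representative of the class of \<open>d0 + j * k\<close> has become minimal,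
  the next step inserts it shifted by \<open>k\<close>.\<close>

lemma class_reached: "\<exists>n i. d0 + real j * k + real i * m \<in> D n"
proof (induction j)
  case 0
  have "d0 + real 0 * k + real 0 * m \<in> D 0" by (simp add: D_0)
  then show ?case by blast
next
  case (Suc j)
  then obtain n i where "d0 + real j * k + real i * m \<in> D n" by blast
  then obtain n' where n': "L n' = d0 + real j * k + real i * m"
    using eventually_minimal by blast
  have "d0 + real (Suc j) * k + real i * m = L n' + k" unfolding n' by (simp add: algebra_simps)
  then show ?case using D_Suc[of n'] by (metis insertI1)
qed

text \<open>The assumption says that \<open>k\<close> has order greater than \<open>M\<close> modulo
  \<open>m\<close>, so the \<open>M + 1\<close> classes of \<open>d0 + j * k\<close> with
  \<open>j \<le> M\<close> are distinct. After finitely many steps all of them are present at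
  once.\<close>

lemma card_gt_eventually:
  assumes "\<And>j i :: nat. 1 \<le> j \<Longrightarrow> j \<le> M \<Longrightarrow> real j * k \<noteq> real i * m"
  shows "\<exists>n0. \<forall>n\<ge>n0. M < card (D n)"
proof -
  from class_reached obtain \<nu> \<iota> where start: "\<And>j. d0 + real j * k + real (\<iota> j) * m \<in> D (\<nu> j)"
    by metis
  have "M < card (D n)" if n: "n \<ge> Max (\<nu> ` {..M})" for n
  proof -
    have "\<exists>i. d0 + real j * k + real i * m \<in> D n" if "j \<le> M" for j
    proof -
      have "\<nu> j \<le> n" using n that by (meson Max_ge atMost_iff finite_atMost finite_imageI imageI le_trans)
      then obtain i where "d0 + real j * k + real (\<iota> j) * m + real i * m \<in> D n"
        using class_persists[OF start] by blast
      then have "d0 + real j * k + real (\<iota> j + i) * m \<in> D n" by (simp add: algebra_simps)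
      then show ?thesis by blast
    qed
    then obtain g where g: "\<And>j. j \<le> M \<Longrightarrow> d0 + real j * k + real (g j) * m \<in> D n" by metis
    let ?f = "\<lambda>j. d0 + real j * k + real (g j) * m"
    have neq: "?f j \<noteq> ?f j'" if "j < j'" "j' \<le> M" for j j'
    proof
      assume "?f j = ?f j'"
      then have eq: "real (j' - j) * k = (real (g j) - real (g j')) * m"
        using that by (simp add: of_nat_diff algebra_simps)
      \<comment> \<open>The sign shows \<open>g j' < g j\<close>, so the coefficient of
        \<open>m\<close> is a natural number, as the assumption on \<open>M\<close> demands.\<close>
      have "0 < real (j' - j) * k" using that k_pos by simp
      with eq have "0 < (real (g j) - real (g j')) * m" by (simp only:)
      then have "g j' < g j" using m_pos by (simp add: zero_less_mult_iff)
      then have "real (j' - j) * k = real (g j - g j') * m" using eq by (simp add: of_nat_diff)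
      moreover have "1 \<le> j' - j" "j' - j \<le> M" using that by auto
      ultimately show False using assms by blast
    qed
    have "inj_on ?f {..M}"
      by (rule inj_onI, unfold atMost_iff) (metis neq nat_neq_iff)
    then have "card (?f ` {..M}) = Suc M" by (simp add: card_image)
    moreover have "card (?f ` {..M}) \<le> card (D n)"
      using g by (intro card_mono finite_D) auto
    ultimately show ?thesis by simp
  qed
  then show ?thesis by blast
qed

text \<open>All depths differ from the minimum by integer multiples of \<delta>, and a half-open
  window of length \<open>q * \<delta>\<close> holds at most \<open>q\<close> such points.\<close>

lemma card_le:
  assumes "\<delta> > 0" and "k = real p * \<delta>" and "m = real q * \<delta>"
  shows "card (D n) \<le> q"
proof -
  have "D n \<subseteq> (\<lambda>i. L n + real i * \<delta>) ` {..<q}"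
  proof
    fix x assume x: "x \<in> D n"
    obtain i j i' j' where "x = d0 + real i * k + real j * m" "L n = d0 + real i' * k + real j' * m"
      using D_combination[OF x] D_combination[OF L_in] by metis
    then have eq: "x - L n = of_int (int (i * p + j * q) - int (i' * p + j' * q)) * \<delta>" (is "_ = of_int ?z * _")
      using assms by (simp add: algebra_simps)
    have "0 \<le> of_int ?z * \<delta>" "of_int ?z * \<delta> < real q * \<delta>"
      using L_le[OF x] D_window[OF x] eq assms(3) by linarith+
    then have z: "0 \<le> ?z" "?z < int q"
      using assms(1) by (simp_all only: zero_le_mult_iff mult_less_cancel_right) linarith+
    have "real (nat ?z) = of_int ?z" using z(1) by (rule of_nat_nat)
    then have "x = L n + real (nat ?z) * \<delta>" using eq by (simp only:)
    moreover have "nat ?z \<in> {..<q}" using z by (simp only: lessThan_iff nat_less_iff)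
    ultimately show "x \<in> (\<lambda>i. L n + real i * \<delta>) ` {..<q}" by (rule image_eqI)
  qed
  then have "card (D n) \<le> card {..<q}" by (rule surj_card_le[rotated]) simp
  then show ?thesis by simp
qed

text \<open>Since \<open>p\<close> and \<open>q\<close> are coprime, \<open>j * p\<close> is a
  multiple of \<open>q\<close> only if \<open>j\<close> is. So \<open>k\<close> has order exactly
  \<open>q\<close> modulo \<open>m\<close>, and the lower bound with \<open>M = q - 1\<close> meets
  the upper bound.\<close>

lemma card_eventually:
  assumes "\<delta> > 0" and "k = real p * \<delta>" and "m = real q * \<delta>" and "coprime p q"
  shows "\<exists>n0. \<forall>n\<ge>n0. card (D n) = q"
proof -
  have "0 < q" using m_pos assms(1,3) by (simp add: zero_less_mult_iff)
  have "real j * k \<noteq> real i * m" if "1 \<le> j" "j \<le> q - 1" for i j :: nat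
  proof
    assume "real j * k = real i * m"
    then have "real (j * p) * \<delta> = real (i * q) * \<delta>" unfolding assms(2,3) by simp
    then have "real (j * p) = real (i * q)" using assms(1) by (simp only: mult_cancel_right) simp
    then have "j * p = i * q" by (simp only: of_nat_eq_iff)
    then have "q dvd j" using assms(4) by (metis coprime_commute coprime_dvd_mult_left_iff dvd_triv_right)
    then show False using that \<open>0 < q\<close> by (auto dest: dvd_imp_le)
  qed
  then obtain n0 where "\<forall>n\<ge>n0. q - 1 < card (D n)" using card_gt_eventually[of "q - 1"] by blast
  then have "\<forall>n\<ge>n0. card (D n) = q" using card_le[OF assms(1-3)] by (metis Suc_pred' \<open>0 < q\<close> Suc_leI le_antisym)
  then show ?thesis by blast
qed

end

section \<open>Sizes under subdivision\<close>

text \<open>Reduces the recognition of a tile to three inner products, which become polynomial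
  identities in coordinates; Pythagoras supplies the hypotenuse.\<close>

lemma right_tileI:
  assumes "a\<^sup>2 + b\<^sup>2 = c\<^sup>2" "0 < a" "0 < b" "0 < c" "0 < r"
    and orth: "(A - C) \<bullet> (B - C) = 0"
    and AC: "(A - C) \<bullet> (A - C) = (r * b)\<^sup>2" and BC: "(B - C) \<bullet> (B - C) = (r * a)\<^sup>2"
  shows "is_tile a b c (A, C, B)" and "hypotenuse (A, C, B) = r * c"
proof -
  have "(A - B) \<bullet> (A - B) = (A - C) \<bullet> (A - C) + (B - C) \<bullet> (B - C) - 2 * ((A - C) \<bullet> (B - C))"
    by (simp add: inner_diff inner_commute)
  also have "\<dots> = (r * c)\<^sup>2"
    unfolding orth AC BC assms(1)[symmetric] power_mult_distrib by (simp add: algebra_simps)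
  finally have AB: "dist A B = r * c"
    using assms by (simp add: dist_norm norm_eq_sqrt_inner)
  moreover have "dist A C = r * b" "dist B C = r * a"
    using assms by (simp_all add: dist_norm norm_eq_sqrt_inner)
  ultimately show "is_tile a b c (A, C, B)" "hypotenuse (A, C, B) = r * c"
    using assms by (auto simp: is_tile_def orthogonal_def hypotenuse_def dist_commute)
qed

lemma subdivide_tile:
  assumes pos: "0 < a" "0 < b" "0 < c" and pyth: "a\<^sup>2 + b\<^sup>2 = c\<^sup>2" and t: "is_tile a b c t"
  shows "\<forall>u\<in>subdivide t. is_tile a b c u"
    and "hypotenuse ` subdivide t = {hypotenuse t * (b / (2 * c)), hypotenuse t * (a / c)}"
proof -
  obtain A C B where tt: "t = (A, C, B)" by (cases t)
  from t obtain r where r: "r > 0" and dists: "dist A C = r * b" "dist C B = r * a" "dist A B = r * c"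
    and orth: "orthogonal (A - C) (B - C)"
    unfolding tt is_tile_def by auto
  define u where "u = A - C"
  define v where "v = B - C"
  \<comment> \<open>This is the square of cos \<theta>, the ratio of AF to AB. With origin C and the
    orthogonal axes \<open>u\<close>, \<open>v\<close> along the legs, all points of the subdivision
    have coordinates affine in \<mu>.\<close>
  define \<mu> where "\<mu> = b\<^sup>2 / c\<^sup>2"
  have A: "A = C + u" and B: "B = C + v" by (simp_all add: u_def v_def)
  have uv: "u \<bullet> v = 0" "v \<bullet> u = 0" using orth by (simp_all add: u_def v_def orthogonal_def inner_commute)
  have uu: "u \<bullet> u = (r * b)\<^sup>2" and vv: "v \<bullet> v = (r * a)\<^sup>2"
    using dists by (simp_all add: u_def v_def dist_norm norm_minus_commute[of C B] flip: power2_norm_eq_inner)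
  have inner: "(x *\<^sub>R u + y *\<^sub>R v) \<bullet> (x' *\<^sub>R u + y' *\<^sub>R v) = x * x' * (r * b)\<^sup>2 + y * y' * (r * a)\<^sup>2"
    for x y x' y' by (simp add: inner_add uv uu vv)
  define F where "F = foot C A B"
  define M where "M = midpoint A C"
  define N where "N = midpoint A F"
  define K where "K = midpoint F C"
  have "(C - A) \<bullet> (B - A) / ((B - A) \<bullet> (B - A)) = \<mu>"
  proof -
    have "(C - A) \<bullet> (B - A) = r\<^sup>2 * b\<^sup>2"
      by (simp add: A B inner_diff uv uu power_mult_distrib)
    moreover have "(B - A) \<bullet> (B - A) = r\<^sup>2 * c\<^sup>2"
      by (simp add: A B inner_diff uv uu vv power_mult_distrib flip: pyth distrib_left)
    ultimately show ?thesis using r by (simp add: \<mu>_def)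
  qed
  then have F: "F = C + ((1 - \<mu>) *\<^sub>R u + \<mu> *\<^sub>R v)"
    by (simp add: F_def foot_def A B algebra_simps)
  have M: "M = C + (1/2) *\<^sub>R u"
    by (simp add: M_def midpoint_def A complex_eq_iff)
  have N: "N = C + ((1 - \<mu>/2) *\<^sub>R u + (\<mu>/2) *\<^sub>R v)"
    by (simp add: N_def midpoint_def A F complex_eq_iff field_simps)
  have K: "K = C + (((1 - \<mu>)/2) *\<^sub>R u + (\<mu>/2) *\<^sub>R v)"
    by (simp add: K_def midpoint_def F complex_eq_iff field_simps)
  \<comment> \<open>Here \<open>s\<close> is the scale of the daughter, and \<open>(x, y)\<close>,
    \<open>(x', y')\<close> are the coordinates of its legs seen from the right angle
    \<open>Y\<close>. The three equations express the right angle and the two leg lengths.\<close>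
  have daughter: "is_tile a b c (X, Y, Z) \<and> hypotenuse (X, Y, Z) = s * c"
    if "0 < s" "X - Y = x *\<^sub>R u + y *\<^sub>R v" "Z - Y = x' *\<^sub>R u + y' *\<^sub>R v"
      "x * x' * (r * b)\<^sup>2 + y * y' * (r * a)\<^sup>2 = 0"
      "x * x * (r * b)\<^sup>2 + y * y * (r * a)\<^sup>2 = (s * b)\<^sup>2"
      "x' * x' * (r * b)\<^sup>2 + y' * y' * (r * a)\<^sup>2 = (s * a)\<^sup>2"
    for X Y Z s x y x' y'
    by (intro conjI right_tileI[OF pyth pos that(1)]; simp only: that(2,3) inner that(4-6))
  note coords = A B F M N K complex_eq_iff
  have b2: "b\<^sup>2 = \<mu> * c\<^sup>2" using pos by (simp add: \<mu>_def)
  then have a2: "a\<^sup>2 = (1 - \<mu>) * c\<^sup>2" using pyth by (simp add: algebra_simps)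
  \<comment> \<open>Eliminates \<open>a\<close> and \<open>b\<close> in favour of \<mu> and
    \<open>c\<close>, so that the conditions on each daughter become polynomial identities.\<close>
  have squares: "(x * b)\<^sup>2 = x\<^sup>2 * (\<mu> * c\<^sup>2)" "(x * a)\<^sup>2 = x\<^sup>2 * ((1 - \<mu>) * c\<^sup>2)"
    "(r * (b / (2 * c)))\<^sup>2 = r\<^sup>2 * \<mu> / 4" "(r * (a / c))\<^sup>2 = r\<^sup>2 * (1 - \<mu>)" for x
    using pos by (simp_all add: power_mult_distrib power_divide a2 b2)
  let ?s = "r * (b / (2 * c))"
  have s: "0 < ?s" "0 < r * (a / c)" using r pos by simp_all
  \<comment> \<open>The four coefficients are the coordinates of \<open>A - N\<close> and
    \<open>M - N\<close> with respect to \<open>u\<close> and \<open>v\<close>; the other daughters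
    follow the same pattern.\<close>
  have 1: "is_tile a b c (A, N, M) \<and> hypotenuse (A, N, M) = ?s * c"
    by (rule daughter[OF s(1), of _ _ "\<mu>/2" "-\<mu>/2" _ "-(1 - \<mu>)/2" "-\<mu>/2"])
       (simp_all only: squares, simp_all add: coords, (simp_all add: field_simps power2_eq_square)?)
  have 2: "is_tile a b c (M, K, C) \<and> hypotenuse (M, K, C) = ?s * c"
    by (rule daughter[OF s(1), of _ _ "\<mu>/2" "-\<mu>/2" _ "-(1 - \<mu>)/2" "-\<mu>/2"])
       (simp_all only: squares, simp_all add: coords, (simp_all add: field_simps power2_eq_square)?)
  have 3: "is_tile a b c (M, K, F) \<and> hypotenuse (M, K, F) = ?s * c"
    by (rule daughter[OF s(1), of _ _ "\<mu>/2" "-\<mu>/2" _ "(1 - \<mu>)/2" "\<mu>/2"])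
       (simp_all only: squares, simp_all add: coords, (simp_all add: field_simps power2_eq_square)?)
  have 4: "is_tile a b c (F, N, M) \<and> hypotenuse (F, N, M) = ?s * c"
    by (rule daughter[OF s(1), of _ _ "-\<mu>/2" "\<mu>/2" _ "-(1 - \<mu>)/2" "-\<mu>/2"])
       (simp_all only: squares, simp_all add: coords, (simp_all add: field_simps power2_eq_square)?)
  have 5: "is_tile a b c (C, F, B) \<and> hypotenuse (C, F, B) = r * (a / c) * c"
    by (rule daughter[OF s(2), of _ _ "-(1 - \<mu>)" "-\<mu>" _ "-(1 - \<mu>)" "1 - \<mu>"])
       (simp_all only: squares, simp_all add: coords, (simp_all add: field_simps power2_eq_square)?)
  have parts: "subdivide t = {(A, N, M), (M, K, C), (M, K, F), (F, N, M), (C, F, B)}"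
    by (simp add: subdivide_def tt Let_def F_def M_def N_def K_def)
  show "\<forall>u\<in>subdivide t. is_tile a b c u"
    using 1 2 3 4 5 unfolding parts by blast
  have "hypotenuse t = r * c" using dists by (simp add: tt hypotenuse_def)
  then show "hypotenuse ` subdivide t = {hypotenuse t * (b / (2 * c)), hypotenuse t * (a / c)}"
    using 1 2 3 4 5 unfolding parts by (simp add: mult_ac)
qed

section \<open>The set of sizes along the iterated subdivision\<close>

lemma subdivision_tiles:
  assumes "0 < a" "0 < b" "0 < c" "a\<^sup>2 + b\<^sup>2 = c\<^sup>2" "is_tile a b c T"
  shows "\<forall>t\<in>subdivision T n. is_tile a b c t"
  using assms(5) subdivide_tile(1)[OF assms(1-4)] by (induction n) auto

lemma finite_subdivision: "finite (subdivision T n)"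
  by (induction n) (auto simp: subdivide_def Let_def split: prod.splits)

lemma subdivision_nonempty: "subdivision T n \<noteq> {}"
proof (induction n)
  case (Suc n)
  then obtain t where "t \<in> subdivision T n" by blast
  moreover have "subdivide t \<noteq> {}" by (simp add: subdivide_def Let_def split: prod.splits)
  ultimately show ?case by auto
qed simp

lemma hypotenuse_pos: "0 < c \<Longrightarrow> is_tile a b c t \<Longrightarrow> 0 < hypotenuse t"
  by (auto simp: is_tile_def hypotenuse_def)

lemma sizes_subdivision_pos:
  assumes "0 < a" "0 < b" "0 < c" "a\<^sup>2 + b\<^sup>2 = c\<^sup>2" "is_tile a b c T"
    and "h \<in> sizes (subdivision T n)"
  shows "0 < h"
proof -
  obtain t where "t \<in> subdivision T n" "h = hypotenuse t" using assms(6) by (auto simp: sizes_def)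
  then show ?thesis using hypotenuse_pos[OF assms(3)] subdivision_tiles[OF assms(1-5)] by blast
qed

text \<open>Every tile of maximal size is split, so that size vanishes; since at least one such tile
  exists, both scaled sizes do occur. Smaller tiles are kept. The maximum can be removed before the
  new sizes are inserted.\<close>

lemma sizes_subdivision_Suc:
  assumes "0 < a" "0 < b" "0 < c" "a\<^sup>2 + b\<^sup>2 = c\<^sup>2" "is_tile a b c T"
  defines "h \<equiv> \<lambda>n. Max (sizes (subdivision T n))"
  shows "sizes (subdivision T (Suc n)) =
    insert (h n * (b / (2 * c))) (insert (h n * (a / c)) (sizes (subdivision T n) - {h n}))"
proof -
  have "h n \<in> sizes (subdivision T n)"
    unfolding h_def sizes_def by (intro Max_in) (simp_all add: finite_subdivision subdivision_nonempty)
  then obtain t where t: "t \<in> subdivision T n" "hypotenuse t = h n" by (auto simp: sizes_def)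
  have split: "hypotenuse ` subdivide u = {h n * (b / (2 * c)), h n * (a / c)}"
    if "u \<in> subdivision T n" "hypotenuse u = h n" for u
    using subdivide_tile(2)[OF assms(1-4)] subdivision_tiles[OF assms(1-5)] that by metis
  have "sizes (subdivision T (Suc n)) =
      (\<Union>u\<in>subdivision T n. if hypotenuse u = h n then hypotenuse ` subdivide u else {hypotenuse u})"
    unfolding subdivision.simps sizes_def h_def image_UN by (intro SUP_cong) auto
  also have "\<dots> = (\<Union>u\<in>subdivision T n. if hypotenuse u = h n
      then {h n * (b / (2 * c)), h n * (a / c)} else {hypotenuse u})"
    using split by (intro SUP_cong) auto
  also have "\<dots> = insert (h n * (b / (2 * c))) (insert (h n * (a / c)) (sizes (subdivision T n) - {h n}))"
    using t by (auto simp: sizes_def split: if_splits)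
  finally show ?thesis .
qed

text \<open>The negative logarithm turns the largest size into the least depth and scaling into
  translation. Which of \<alpha> and \<beta> is smaller depends on the angle, hence
  \<open>min\<close> and \<open>max\<close>.\<close>

lemma depth_process_subdivision:
  assumes "0 < a" "0 < b" "0 < c" "a\<^sup>2 + b\<^sup>2 = c\<^sup>2" "is_tile a b c T"
  defines "\<alpha> \<equiv> - ln (a / c)" and "\<beta> \<equiv> - ln (b / (2 * c))"
  shows "depth_process (min \<alpha> \<beta>) (max \<alpha> \<beta>) (\<lambda>n. (\<lambda>h. - ln h) ` sizes (subdivision T n)) (- ln (hypotenuse T))"
proof
  have "a\<^sup>2 < c\<^sup>2" "b\<^sup>2 < c\<^sup>2" using assms(1,2,4) by (smt (verit) zero_less_power)+
  then have "a < c" "b < c" using assms(1-3) by (auto intro: power_less_imp_less_base)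
  then show "0 < min \<alpha> \<beta>" using assms(1-3) by (simp add: \<alpha>_def \<beta>_def)
  show "min \<alpha> \<beta> \<le> max \<alpha> \<beta>" by simp
  show "(\<lambda>h. - ln h) ` sizes (subdivision T 0) = {- ln (hypotenuse T)}" by (simp add: sizes_def)
  fix n
  let ?H = "sizes (subdivision T n)"
  let ?D = "(\<lambda>h. - ln h) ` ?H"
  have H: "finite ?H" "?H \<noteq> {}" by (simp_all add: sizes_def finite_subdivision subdivision_nonempty)
  have pos: "0 < h" if "h \<in> ?H" for h
    by (rule sizes_subdivision_pos[OF assms(1-5) that])
  define h where "h = Max ?H"
  have h: "h \<in> ?H" "\<And>x. x \<in> ?H \<Longrightarrow> x \<le> h" unfolding h_def using H by simp_all
  have Min: "Min ?D = - ln h"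
    using H h pos by (intro Min_eqI) auto
  \<comment> \<open>Injectivity lets the image commute with the removal of the maximal size.\<close>
  have inj: "inj_on (\<lambda>h. - ln h) ?H" by (rule inj_onI) (use pos in simp)
  have logs: "- ln (h * (a / c)) = - ln h + \<alpha>" "- ln (h * (b / (2 * c))) = - ln h + \<beta>"
    using pos[OF h(1)] assms(1-3) by (simp_all only: ln_mult_pos \<alpha>_def \<beta>_def divide_pos_pos mult_pos_pos zero_less_numeral)
  have "(\<lambda>h. - ln h) ` sizes (subdivision T (Suc n)) = insert (- ln h + \<beta>) (insert (- ln h + \<alpha>) (?D - {- ln h}))"
    unfolding sizes_subdivision_Suc[OF assms(1-5)] h_def[symmetric] image_insert logs
    using inj_on_image_set_diff[OF inj, of ?H "{h}"] h(1) by simp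
  also have "\<dots> = insert (- ln h + min \<alpha> \<beta>) (insert (- ln h + max \<alpha> \<beta>) (?D - {- ln h}))"
    by (cases "\<alpha> \<le> \<beta>") auto
  finally show "(\<lambda>h. - ln h) ` sizes (subdivision T (Suc n)) =
      insert (Min ?D + min \<alpha> \<beta>) (insert (Min ?D + max \<alpha> \<beta>) (?D - {Min ?D}))"
    unfolding Min .
qed

lemma card_depths_eq_card_sizes:
  assumes "0 < a" "0 < b" "0 < c" "a\<^sup>2 + b\<^sup>2 = c\<^sup>2" "is_tile a b c T"
  shows "card ((\<lambda>h. - ln h) ` sizes (subdivision T n)) = card (sizes (subdivision T n))"
proof (rule card_image, rule inj_onI)
  fix x y assume "x \<in> sizes (subdivision T n)" "y \<in> sizes (subdivision T n)" and eq: "- ln x = - ln y"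
  then have "0 < x" "0 < y"
    by (auto intro: sizes_subdivision_pos[OF assms])
  then show "x = y" using eq by simp
qed

section \<open>Supertiles and the tiling\<close>

lemma card_sizes_supertile:
  assumes "supertile T n S"
  shows "finite (sizes S)" and "card (sizes S) = card (sizes (subdivision T n))"
proof -
  obtain e r where e: "euclidean_motion e" and r: "r > 0"
    and S: "S = map_tile (\<lambda>z. e (r *\<^sub>R z)) ` subdivision T n"
    using assms by (auto simp: supertile_def placement_def)
  have "hypotenuse (map_tile (\<lambda>z. e (r *\<^sub>R z)) t) = r * hypotenuse t" for t
    using e r by (auto simp: hypotenuse_def map_tile_def euclidean_motion_def dist_norm
        simp flip: scaleR_diff_right split: prod.splits)
  then have eq: "sizes S = (\<lambda>h. r * h) ` sizes (subdivision T n)"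
    by (simp add: S sizes_def image_image)
  show "finite (sizes S)" unfolding S sizes_def by (simp add: finite_subdivision)
  have "inj_on (\<lambda>h. r * h) (sizes (subdivision T n))" using r by (simp add: inj_on_def)
  then show "card (sizes S) = card (sizes (subdivision T n))" unfolding eq by (rule card_image)
qed

theorem theorem3:
  fixes a b c \<theta> :: real and T :: tile and \<T> :: "tile set"
  assumes "a > 0" and "b > 0" and "c > 0" and "a\<^sup>2 + b\<^sup>2 = c\<^sup>2"
    and "\<theta> = arcsin (a / c)" and "0 < \<theta>" and "\<theta> < pi / 2"
    and "is_tile a b c T" and "hypotenuse T = c"
    and "hierarchical_tiling T \<T>"
  shows "(ln (sin \<theta>) / ln (cos \<theta> / 2) \<notin> \<rat> \<longrightarrow> infinite (sizes \<T>)) \<and>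
         (ln (sin \<theta>) / ln (cos \<theta> / 2) \<in> \<rat> \<longrightarrow> finite (sizes \<T>)) \<and>
         (\<forall>p q :: nat. p > 0 \<and> q > 0 \<and> coprime p q \<and>
            ln (sin \<theta>) / ln (cos \<theta> / 2) = real p / real q \<longrightarrow>
            finite (sizes \<T>) \<and> card (sizes \<T>) = max p q)"
proof -
  note tile = assms(1-4,8)
  define \<alpha> where "\<alpha> = - ln (a / c)"
  define \<beta> where "\<beta> = - ln (b / (2 * c))"
  define D where "D n = (\<lambda>h. - ln h) ` sizes (subdivision T n)" for n
  interpret depth_process "min \<alpha> \<beta>" "max \<alpha> \<beta>" D "- ln (hypotenuse T)"
    unfolding D_def \<alpha>_def \<beta>_def by (rule depth_process_subdivision[OF tile])
  have pos: "0 < \<alpha>" "0 < \<beta>" using k_pos by simp_all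
  have "a\<^sup>2 < c\<^sup>2" using assms(2,4) by (smt (verit) zero_less_power)
  then have ac: "a / c \<le> 1" "0 \<le> a / c" using assms(1,3) by (auto dest: power_less_imp_less_base)
  have sin: "sin \<theta> = a / c" using ac by (simp add: assms(5))
  have "cos \<theta> = sqrt (1 - (a / c)\<^sup>2)" using ac by (simp add: assms(5) cos_arcsin)
  also have "1 - (a / c)\<^sup>2 = (b / c)\<^sup>2" using assms(3,4) by (simp add: power_divide field_simps)
  finally have cos: "cos \<theta> = b / c" using assms(2,3) by simp
  \<comment> \<open>The signs of the two logarithms cancel, so the ratio in the theorem is that of
    the two positive shifts.\<close>
  have ratio: "ln (sin \<theta>) / ln (cos \<theta> / 2) = \<alpha> / \<beta>"
    by (simp add: sin cos \<alpha>_def \<beta>_def mult.commute)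

  obtain S N where \<T>: "\<T> = (\<Union>i. S i)" and chain: "\<And>i. S i \<subset> S (Suc i)"
    and N: "strict_mono N" and super: "\<And>i. supertile T (N i) (S i)"
    using assms(10) unfolding hierarchical_tiling_def by blast
  have sizes_\<T>: "sizes \<T> = (\<Union>i. sizes (S i))" by (simp add: \<T> sizes_def image_UN)
  have mono: "sizes (S i) \<subseteq> sizes (S j)" if "i \<le> j" for i j
    using lift_Suc_mono_le[of S, OF _ that] chain unfolding sizes_def by (intro image_mono) auto
  have fin: "finite (sizes (S i))" for i by (rule card_sizes_supertile(1)[OF super])
  have card: "card (sizes (S i)) = card (D (N i))" for i
    unfolding D_def card_sizes_supertile(2)[OF super] card_depths_eq_card_sizes[OF tile] ..

  have irrational: "infinite (sizes \<T>)" if irr: "\<alpha> / \<beta> \<notin> \<rat>"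
  proof
    assume finite: "finite (sizes \<T>)"
    \<comment> \<open>In the irrational case the smaller shift has infinite order modulo the larger
      one, so the counts exceed every bound; the bound refuted below is the supposed finite number
      of sizes of the tiling.\<close>
    have "real j * min \<alpha> \<beta> \<noteq> real i * max \<alpha> \<beta>" if "1 \<le> j" for i j :: nat
    proof
      assume eq: "real j * min \<alpha> \<beta> = real i * max \<alpha> \<beta>"
      have "0 < real j * min \<alpha> \<beta>" using that pos by simp
      then have "0 < i" using eq by (cases i) auto
      then have "\<alpha> / \<beta> = real i / real j \<or> \<alpha> / \<beta> = real j / real i"
        using eq that pos by (cases "\<alpha> \<le> \<beta>") (auto simp: field_simps)
      then have "\<alpha> / \<beta> \<in> \<rat>" by auto
      with irr show False by contradiction
    qed
    then obtain n0 where n0: "\<And>n. n \<ge> n0 \<Longrightarrow> card (sizes \<T>) < card (D n)"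
      using card_gt_eventually by blast
    \<comment> \<open>The order \<open>N n0\<close> is at least \<open>n0\<close> because
      \<open>N\<close> is strictly increasing.\<close>
    have "card (sizes \<T>) < card (sizes (S n0))"
      unfolding card using strict_mono_imp_increasing[OF N] by (intro n0)
    moreover have "card (sizes (S n0)) \<le> card (sizes \<T>)"
      unfolding sizes_\<T> by (rule card_mono) (use finite sizes_\<T> in auto)
    ultimately show False by simp
  qed

  have rational: "finite (sizes \<T>) \<and> card (sizes \<T>) = max p q"
    if "p > 0" "q > 0" "coprime p q" "\<alpha> / \<beta> = real p / real q" for p q :: nat
  proof -
    \<comment> \<open>A common measure of both shifts: \<alpha> is \<open>p\<close> times and
      \<beta> is \<open>q\<close> times \<delta>. The larger shift, which serves as modulus, is
      therefore \<open>max p q\<close> times \<delta>.\<close>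
    define \<delta> where "\<delta> = \<beta> / real q"
    have \<delta>: "0 < \<delta>" "\<alpha> = real p * \<delta>" "\<beta> = real q * \<delta>"
      using that pos by (simp_all add: \<delta>_def field_simps)
    have "min \<alpha> \<beta> = real (min p q) * \<delta>" "max \<alpha> \<beta> = real (max p q) * \<delta>"
      using \<delta>(1) by (simp_all add: \<delta>(2,3) min_def max_def)
    moreover have "coprime (min p q) (max p q)"
      using that(3) by (simp add: min_def max_def coprime_commute)
    ultimately obtain n0 where n0: "\<And>n. n \<ge> n0 \<Longrightarrow> card (D n) = max p q"
      using card_eventually[OF \<delta>(1)] by metis
    have c: "card (sizes (S i)) = max p q" if "i \<ge> n0" for i
      unfolding card using strict_mono_imp_increasing[OF N, of i] that by (intro n0) simp
    \<comment> \<open>From index \<open>n0\<close> on, the nested finite sets of sizes have equal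
      cardinality, so the chain is constant there.\<close>
    have "sizes (S i) \<subseteq> sizes (S n0)" for i
    proof -
      have "sizes (S n0) = sizes (S (max i n0))"
        by (intro card_subset_eq fin mono) (simp_all add: c)
      then show ?thesis using mono[of i "max i n0"] by simp
    qed
    then have "sizes \<T> = sizes (S n0)" unfolding sizes_\<T> by blast
    then show ?thesis using fin c by simp
  qed

  have "finite (sizes \<T>)" if rat: "\<alpha> / \<beta> \<in> \<rat>"
  proof -
    \<comment> \<open>The fraction in lowest terms is given for the absolute value; positivity of
      the ratio removes the bars and forces \<open>p > 0\<close>.\<close>
    obtain p q :: nat where "q \<noteq> 0" "\<bar>\<alpha> / \<beta>\<bar> = real p / real q" "coprime p q"
      using Rats_abs_nat_div_natE[OF rat] .
    moreover from calculation have "\<alpha> / \<beta> = real p / real q" using pos by simp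
    moreover from calculation have "p > 0" using pos by (cases p) auto
    ultimately show ?thesis using rational by blast
  qed
  with irrational rational show ?thesis unfolding ratio by blast
qed

end
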